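(* Let $\beta>1$ be a real number. Then the Tsallis entropy $$H_\beta^T(p_1,\dots,p_n)=\frac{1}{\beta-1}\Big(1-\sum_{i=1}^n p_i^\beta\Big),\qquad (p_1,\dots,p_n)\in\Omega_n,\ n\ge1,$$ is an upper entropy function.
   Context: For each integer $N\ge 1$ let $\Omega_N=\{(p_1,\dots,p_N): p_i\ge 0,\ \sum_{i=1}^N p_i=1\}$, and let $\Omega=\bigcup_{N\ge1}\Omega_N$. A function $H:\Omega\to\mathbb{R}$ is called an upper entropy function if it satisfies: (i) Continuity: the restriction of $H$ to each $\Omega_N$ is continuous, and $H(p_1,\dots,p_N)=0$ if and only if there is $k$ with $p_k=1$. (ii) Symmetry: $H(p_1,\dots,p_N)$ is invariant under permutations of its arguments. (iii) Increasing property: if $(p_1,\dots,p_N)\in\Omega_N$, $1\le n\le N$, $m\ge1$, $q_1,\dots,q_m\ge 0$ and $p_n=\sum_{i=1}^m q_i$, then $$0\le H(p_1,\dots,p_{n-1},q_1,\dots,q_m,p_{n+1},\dots,p_N)-H(p_1,\dots,p_N)\le p_n H\Big(\frac{q_1}{p_n},\dots,\frac{q_m}{p_n}\Big),$$ where the right-hand side is read as $0$ when $p_n=0$. (iv) Maximum: for every $N\ge1$ and $(p_1,\dots,p_N)\in\Omega_N$, $H(p_1,\dots,p_N)\le H(\frac1N,\dots,\frac1N)$. *)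

theory Defs
  imports "HOL-Analysis.Analysis"
begin

text \<open>
  A finite probability distribution \<open>(p\<^sub>1, \<dots>, p\<^sub>N)\<close> is the list \<open>[p\<^sub>1, \<dots>, p\<^sub>N]\<close>; list positions
  start at 0. Entropy functions are total on \<^typ>\<open>real list\<close>, and every condition on them concerns
  only their values on \<open>Omega\<close>.
\<close>

definition Omega_N :: "nat \<Rightarrow> real list set" where
  "Omega_N N = {p. length p = N \<and> (\<forall>i<N. 0 \<le> p ! i) \<and> (\<Sum>i<N. p ! i) = 1}"

definition Omega :: "real list set" where
  "Omega = (\<Union>N\<in>{1..}. Omega_N N)"

text \<open>
  Lists of length \<open>N\<close> inherit the topology of \<open>\<real>\<^sup>N\<close>: \<^term>\<open>Euclidean_space N\<close> consists of the
  \<open>x :: nat \<Rightarrow> real\<close> with \<open>x i = 0\<close> for \<open>i \<ge> N\<close>, identified with the list \<open>[x 0, \<dots>, x (N - 1)]\<close>.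
\<close>

definition continuous_on_Omega_N :: "nat \<Rightarrow> (real list \<Rightarrow> real) \<Rightarrow> bool" where
  "continuous_on_Omega_N N H \<longleftrightarrow>
     continuous_map (subtopology (Euclidean_space N) {x. map x [0..<N] \<in> Omega_N N}) euclideanreal
       (\<lambda>x. H (map x [0..<N]))"

definition entropy_continuity :: "(real list \<Rightarrow> real) \<Rightarrow> bool" where
  "entropy_continuity H \<longleftrightarrow>
     (\<forall>N\<ge>1. continuous_on_Omega_N N H) \<and>
     (\<forall>p\<in>Omega. H p = 0 \<longleftrightarrow> (\<exists>k<length p. p ! k = 1))"

definition entropy_symmetry :: "(real list \<Rightarrow> real) \<Rightarrow> bool" where
  "entropy_symmetry H \<longleftrightarrow>
     (\<forall>p\<in>Omega. \<forall>\<pi>. \<pi> permutes {..<length p} \<longrightarrow> H (permute_list \<pi> p) = H p)"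

text \<open>
  Here \<open>ps\<close> and \<open>rs\<close> are the (possibly empty) blocks \<open>p\<^sub>1, \<dots>, p\<^bsub>n-1\<^esub>\<close> and \<open>p\<^bsub>n+1\<^esub>, \<dots>, p\<^sub>N\<close>.
\<close>

definition entropy_increasing :: "(real list \<Rightarrow> real) \<Rightarrow> bool" where
  "entropy_increasing H \<longleftrightarrow>
     (\<forall>ps pn rs qs. ps @ [pn] @ rs \<in> Omega \<longrightarrow> length qs \<ge> 1 \<longrightarrow>
        (\<forall>q\<in>set qs. 0 \<le> q) \<longrightarrow> pn = sum_list qs \<longrightarrow>
        0 \<le> H (ps @ qs @ rs) - H (ps @ [pn] @ rs) \<and>
        H (ps @ qs @ rs) - H (ps @ [pn] @ rs)
          \<le> (if pn = 0 then 0 else pn * H (map (\<lambda>q. q / pn) qs)))"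

definition entropy_maximum :: "(real list \<Rightarrow> real) \<Rightarrow> bool" where
  "entropy_maximum H \<longleftrightarrow>
     (\<forall>N\<ge>1. \<forall>p\<in>Omega_N N. H p \<le> H (replicate N (1 / real N)))"

definition upper_entropy_function :: "(real list \<Rightarrow> real) \<Rightarrow> bool" where
  "upper_entropy_function H \<longleftrightarrow>
     entropy_continuity H \<and> entropy_symmetry H \<and> entropy_increasing H \<and> entropy_maximum H"

definition tsallis_entropy :: "real \<Rightarrow> real list \<Rightarrow> real" where
  "tsallis_entropy \<beta> p = 1 / (\<beta> - 1) * (1 - (\<Sum>i<length p. (p ! i) powr \<beta>))"

end

theory Submission
  imports Defs
begin

text \<open>
  Everything rests on comparing \<open>x powr \<beta>\<close> with linear functions of \<open>x\<close>. On \<open>[0, 1]\<close> the graph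
  lies below its chord, \<open>x powr \<beta> \<le> x\<close>, touching it only at the end points: hence the entropy
  vanishes exactly when all entries are \<open>0\<close> or \<open>1\<close>. After rescaling, the same chord bound says that
  the power sum \<open>S\<close> of a block with sum \<open>P\<close> is at most \<open>P powr \<beta>\<close>.

  Splitting an entry \<open>P > 0\<close> into such a block changes the entropy by \<open>(P powr \<beta> - S) / (\<beta> - 1) \<ge> 0\<close>.
  The bound allowed by the increasing property is the same quantity multiplied by
  \<open>P powr (1 - \<beta>)\<close>, and that factor is at least \<open>1\<close> because \<open>P \<le> 1\<close> and \<open>\<beta> > 1\<close>.

  For the maximum, the graph lies above its tangent at \<open>1\<close>. Applying this to \<open>N * p\<^sub>i\<close> and summing,
  the linear terms cancel since their mean is \<open>1\<close>; this bounds the power sum below by its value at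
  the uniform distribution.
\<close>

section \<open>Comparing powers with linear functions\<close>

lemma powr_le_self:
  fixes x b :: real
  assumes "0 \<le> x" "x \<le> 1" "1 \<le> b"
  shows "x powr b \<le> x"
  using powr_mono'[of 1 b x] assms by simp

lemma powr_eq_self_iff:
  fixes x b :: real
  assumes "0 \<le> x" "1 < b"
  shows "x powr b = x \<longleftrightarrow> x = 0 \<or> x = 1"
proof
  assume eq: "x powr b = x"
  show "x = 0 \<or> x = 1"
  proof (rule ccontr)
    assume "\<not> (x = 0 \<or> x = 1)"
    with assms have "x > 0" "x \<noteq> 1" by auto
    moreover from this have "x powr b = x powr 1" using eq by simp
    ultimately show False using powr_inj[of x b 1] assms by simp
  qed
qed auto

text \<open>
  Young's inequality with second factor \<open>1\<close>, which is the tangent bound including the end point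
  \<open>x = 0\<close>.
\<close>

lemma powr_ge_tangent_at_1:
  fixes x b :: real
  assumes "0 \<le> x" "1 < b"
  shows "1 + b * (x - 1) \<le> x powr b"
proof -
  have "x * 1 \<le> x powr b / b + 1 powr (b / (b - 1)) / (b / (b - 1))"
    by (rule Youngs_inequality) (use assms in \<open>auto simp: field_simps\<close>)
  also have "\<dots> = (x powr b + (b - 1)) / b"
    using assms by (simp add: add_divide_distrib)
  finally have "x * b \<le> x powr b + (b - 1)"
    using assms by (simp add: pos_le_divide_eq)
  then show ?thesis
    by (simp add: algebra_simps)
qed

text \<open>
  Each entry divided by the total \<open>P\<close> lies in \<open>[0, 1]\<close>, so the chord bound gives
  \<open>x powr b \<le> x * P powr (b - 1)\<close>, and these bounds add up to \<open>P powr b\<close>.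
\<close>

lemma sum_list_powr_le:
  fixes b :: real
  assumes nonneg: "\<And>x. x \<in> set xs \<Longrightarrow> 0 \<le> x" and b: "1 \<le> b"
  shows "(\<Sum>x\<leftarrow>xs. x powr b) \<le> sum_list xs powr b"
proof -
  define P where "P = sum_list xs"
  have "x powr b \<le> x * P powr (b - 1)" if x: "x \<in> set xs" for x
  proof -
    have "x \<ge> 0" "x \<le> P"
      using x nonneg unfolding P_def by (auto intro: member_le_sum_list)
    then have "x powr (b - 1) \<le> P powr (b - 1)"
      using b by (intro powr_mono2) auto
    moreover have "x powr b = x * x powr (b - 1)"
      using \<open>x \<ge> 0\<close> by (simp add: powr_mult_base)
    ultimately show ?thesis
      using \<open>x \<ge> 0\<close> by (simp add: mult_left_mono)
  qed
  then have "(\<Sum>x\<leftarrow>xs. x powr b) \<le> (\<Sum>x\<leftarrow>xs. x * P powr (b - 1))"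
    by (rule sum_list_mono)
  also have "\<dots> = P * P powr (b - 1)"
    by (simp add: P_def sum_list_mult_const)
  also have "\<dots> = P powr b"
    using sum_list_nonneg[of xs] nonneg by (simp add: P_def powr_mult_base)
  finally show ?thesis by (simp add: P_def)
qed

section \<open>Tsallis entropy as a sum over a list\<close>

lemma tsallis_entropy_sum_list:
  "tsallis_entropy b p = (1 - (\<Sum>x\<leftarrow>p. x powr b)) / (b - 1)"
  by (simp add: tsallis_entropy_def sum_list_sum_nth lessThan_atLeast0)

lemma Omega_N_iff:
  "p \<in> Omega_N N \<longleftrightarrow> length p = N \<and> (\<forall>x\<in>set p. 0 \<le> x) \<and> sum_list p = 1"
  by (auto simp: Omega_N_def sum_list_sum_nth lessThan_atLeast0 all_set_conv_all_nth)

lemma OmegaD: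
  assumes "p \<in> Omega"
  shows "\<And>x. x \<in> set p \<Longrightarrow> 0 \<le> x" "sum_list p = 1"
  using assms by (auto simp: Omega_def Omega_N_iff)

section \<open>The four axioms\<close>

lemma continuous_on_Omega_N_tsallis:
  assumes "0 < b"
  shows "continuous_on_Omega_N N (tsallis_entropy b)"
proof -
  let ?X = "subtopology (Euclidean_space N) {x. map x [0..<N] \<in> Omega_N N}"
  have "continuous_map ?X euclideanreal (\<lambda>x. x i powr b)" if "i < N" for i
  proof -
    have "continuous_map ?X euclideanreal (\<lambda>x. x i)"
      unfolding Euclidean_space_def
      by (intro continuous_map_from_subtopology continuous_map_product_projection) simp
    then have "continuous_map ?X (top_of_set {0..}) (\<lambda>x. x i)"
      using that by (auto simp: continuous_map_in_subtopology Omega_N_def)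
    moreover have "continuous_map (top_of_set {0..}) euclideanreal (\<lambda>t::real. t powr b)"
      unfolding continuous_map_iff_continuous
      using assms by (intro continuous_on_powr' continuous_intros) auto
    ultimately show ?thesis
      by (rule continuous_map_compose[unfolded o_def])
  qed
  then have "continuous_map ?X euclideanreal (\<lambda>x. 1 / (b - 1) * (1 - (\<Sum>i<N. x i powr b)))"
    by (intro continuous_map_real_mult continuous_map_diff continuous_map_sum) auto
  moreover have "tsallis_entropy b (map x [0..<N]) = 1 / (b - 1) * (1 - (\<Sum>i<N. x i powr b))"
    for x
    by (simp add: tsallis_entropy_def)
  ultimately show ?thesis
    by (simp only: continuous_on_Omega_N_def)
qed

lemma tsallis_entropy_eq_0_iff:
  assumes b: "1 < b" and p: "p \<in> Omega"
  shows "tsallis_entropy b p = 0 \<longleftrightarrow> (\<exists>k<length p. p ! k = 1)"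
proof -
  note nonneg = OmegaD(1)[OF p] and total = OmegaD(2)[OF p]
  have le1: "x \<le> 1" if "x \<in> set p" for x
    using member_le_sum_list[of x p] that nonneg total by auto
  have total_nth: "(\<Sum>i<length p. p ! i) = 1"
    using total by (simp add: sum_list_sum_nth lessThan_atLeast0)
  show ?thesis
  proof
    assume "tsallis_entropy b p = 0"
    \<comment> \<open>The chord bounds sum to an equality, so each of them is an equality.\<close>
    then have "(\<Sum>i<length p. p ! i - p ! i powr b) = 0"
      using b total_nth by (simp add: tsallis_entropy_def sum_subtractf)
    then have "\<forall>i<length p. p ! i - p ! i powr b = 0"
      using b nonneg le1 by (subst (asm) sum_nonneg_eq_0_iff) (auto simp: powr_le_self)
    then have zero_one: "p ! i = 0 \<or> p ! i = 1" if "i < length p" for i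
      using that b nonneg powr_eq_self_iff[of "p ! i" b] by auto
    show "\<exists>k<length p. p ! k = 1"
    proof (rule ccontr)
      assume "\<not> (\<exists>k<length p. p ! k = 1)"
      then have "(\<Sum>i<length p. p ! i) = 0"
        using zero_one by (intro sum.neutral) auto
      with total_nth show False by simp
    qed
  next
    assume "\<exists>k<length p. p ! k = 1"
    then obtain k where k: "k < length p" "p ! k = 1" by auto
    then have "(\<Sum>i\<in>{..<length p} - {k}. p ! i) = 0"
      using total_nth by (simp add: sum.remove[of _ k])
    then have "p ! i = 0" if "i < length p" "i \<noteq> k" for i
      using that nonneg by (subst (asm) sum_nonneg_eq_0_iff) auto
    then have "(\<Sum>i\<in>{..<length p} - {k}. p ! i powr b) = 0"
      by (intro sum.neutral) auto
    with k have "(\<Sum>i<length p. p ! i powr b) = 1"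
      by (simp add: sum.remove[of _ k])
    then show "tsallis_entropy b p = 0"
      by (simp add: tsallis_entropy_def)
  qed
qed

lemma entropy_symmetry_tsallis: "entropy_symmetry (tsallis_entropy b)"
proof -
  have "(\<Sum>x\<leftarrow>permute_list \<pi> p. x powr b) = (\<Sum>x\<leftarrow>p. x powr b)"
    if "\<pi> permutes {..<length p}" for \<pi> and p :: "real list"
    using that by (simp flip: sum_mset_sum_list)
  then show ?thesis
    by (simp add: entropy_symmetry_def tsallis_entropy_sum_list)
qed

text \<open>
  Both inequalities concern the gain \<open>D = P powr b - (\<Sum>q\<leftarrow>qs. q powr b)\<close>. Normalising the block
  turns \<open>P\<close> times its entropy into \<open>P powr (1 - b) * D / (b - 1)\<close> if \<open>P \<noteq> 0\<close>; if \<open>P = 0\<close>,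
  the block is zero and \<open>D = 0\<close>.
\<close>

lemma entropy_increasing_tsallis:
  assumes b: "1 < b"
  shows "entropy_increasing (tsallis_entropy b)"
  unfolding entropy_increasing_def
proof (intro allI impI)
  fix ps rs qs :: "real list" and P :: real
  assume Om: "ps @ [P] @ rs \<in> Omega" and "length qs \<ge> 1"
    and qs: "\<forall>q\<in>set qs. 0 \<le> q" and P: "P = sum_list qs"
  define S where "S = (\<Sum>q\<leftarrow>qs. q powr b)"
  have P0: "0 \<le> P" and P1: "P \<le> 1"
    using OmegaD(1)[OF Om] member_le_sum_list[of P "ps @ [P] @ rs"] OmegaD(2)[OF Om] by auto
  have SP: "S \<le> P powr b"
    unfolding S_def P using qs b by (intro sum_list_powr_le) auto
  have S0: "0 \<le> S"
    unfolding S_def by (intro sum_list_nonneg) auto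
  have diff: "tsallis_entropy b (ps @ qs @ rs) - tsallis_entropy b (ps @ [P] @ rs)
      = (P powr b - S) / (b - 1)"
    by (simp add: tsallis_entropy_sum_list S_def flip: diff_divide_distrib)
  have "(P powr b - S) / (b - 1)
      \<le> (if P = 0 then 0 else P * tsallis_entropy b (map (\<lambda>q. q / P) qs))"
  proof (cases "P = 0")
    case True
    with SP S0 b show ?thesis by simp
  next
    case False
    with P0 have "P > 0" by simp
    have "(\<Sum>q\<leftarrow>qs. (q / P) powr b) = (\<Sum>q\<leftarrow>qs. q powr b * (1 / P powr b))"
      using qs P0 by (intro arg_cong[where f = sum_list] map_cong) (auto simp: powr_divide)
    also have "\<dots> = S / P powr b"
      by (simp only: sum_list_mult_const S_def) simp
    finally have "P * tsallis_entropy b (map (\<lambda>q. q / P) qs)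
        = P * (1 - S / P powr b) / (b - 1)"
      by (simp add: tsallis_entropy_sum_list o_def)
    also have "P * (1 - S / P powr b) = P powr (1 - b) * (P powr b - S)"
      using \<open>P > 0\<close> by (simp add: powr_diff field_simps)
    finally have norm: "P * tsallis_entropy b (map (\<lambda>q. q / P) qs)
        = P powr (1 - b) * (P powr b - S) / (b - 1)" .
    have "1 \<le> P powr (1 - b)"
      using powr_mono'[of "1 - b" 0 P] \<open>P > 0\<close> P1 b by simp
    then have "1 * (P powr b - S) \<le> P powr (1 - b) * (P powr b - S)"
      using SP by (intro mult_right_mono) auto
    with b norm False show ?thesis
      by (simp add: divide_right_mono)
  qed
  moreover have "0 \<le> (P powr b - S) / (b - 1)"
    using SP b by simp
  ultimately show "0 \<le> tsallis_entropy b (ps @ qs @ rs) - tsallis_entropy b (ps @ [P] @ rs) \<and>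
      tsallis_entropy b (ps @ qs @ rs) - tsallis_entropy b (ps @ [P] @ rs)
        \<le> (if P = 0 then 0 else P * tsallis_entropy b (map (\<lambda>q. q / P) qs))"
    unfolding diff by blast
qed

lemma entropy_maximum_tsallis:
  assumes b: "1 < b"
  shows "entropy_maximum (tsallis_entropy b)"
  unfolding entropy_maximum_def
proof (intro allI impI ballI)
  fix N :: nat and p :: "real list"
  assume N: "1 \<le> N" and "p \<in> Omega_N N"
  then have len: "length p = N" and nonneg: "\<And>i. i < N \<Longrightarrow> 0 \<le> p ! i"
    and total: "(\<Sum>i<N. p ! i) = 1"
    by (auto simp: Omega_N_def)
  have "real N = (\<Sum>i<N. 1 + b * (real N * p ! i - 1))"
    using total by (simp add: sum.distrib sum_subtractf flip: sum_distrib_left)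
  also have "\<dots> \<le> (\<Sum>i<N. (real N * p ! i) powr b)"
    using nonneg b by (intro sum_mono powr_ge_tangent_at_1) auto
  also have "\<dots> = real N powr b * (\<Sum>i<N. p ! i powr b)"
    using nonneg by (simp add: powr_mult sum_distrib_left)
  finally have "real N * (1 / real N) powr b \<le> (\<Sum>i<N. p ! i powr b)"
    using N by (simp add: powr_divide field_simps)
  then show "tsallis_entropy b p \<le> tsallis_entropy b (replicate N (1 / real N))"
    using b len by (simp add: tsallis_entropy_def divide_right_mono)
qed

theorem mainTheorem5:
  fixes \<beta> :: real
  assumes "\<beta> > 1"
  shows "upper_entropy_function (tsallis_entropy \<beta>)"
  using assms continuous_on_Omega_N_tsallis tsallis_entropy_eq_0_iff entropy_symmetry_tsallis
    entropy_increasing_tsallis entropy_maximum_tsallis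
  by (simp add: upper_entropy_function_def entropy_continuity_def)

end
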